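(* Let $V$ be the $\mathcal O_q$-module, $L$ the Lusztig automorphism of $\mathcal O_q$, and $H\in\mathrm{End}(V)$ the invertible map described in the context. The following $\mathcal O_q$-modules are isomorphic: (i) the $\mathcal O_q$-module $V$; (ii) the $\mathcal O_q$-module $V$ twisted via $L$; (iii) the $\mathcal O_q$-module $V$ twisted via $L^{-1}$. Moreover, the map $H$ is an isomorphism of $\mathcal O_q$-modules from (i) to (ii) and from (iii) to (i).
   Context: Setting. $\mathbb F$ is a field and $q\in\mathbb F$ is nonzero and not a root of unity. Algebras are associative, unital, over $\mathbb F$. Write $[X,Y]=XY-YX$, $[X,Y]_q=qXY-q^{-1}YX$, $[X,Y]_{q^{-1}}=q^{-1}XY-qYX$. The $q$-Onsager algebra $\mathcal O_q$ is defined by generators $A,A^*$ and relations $[A,[A,[A,A^*]_q]_{q^{-1}}]=(q^2-q^{-2})^2[A^*,A]$ and $[A^*,[A^*,[A^*,A]_q]_{q^{-1}}]=(q^2-q^{-2})^2[A,A^*]$. $V$ is an irreducible $\mathcal O_q$-module of finite dimension at least $2$ on which each of $A,A^*$ is diagonalizable. Eigenspaces. The eigenvalues of $A$ on $V$ can be ordered as mutually distinct $\theta_0,\dots,\theta_d$ ($d\ge 1$) such that $\theta_i=aq^{d-2i}+a^{-1}q^{2i-d}$ ($0\le i\le d$) for some nonzero $a\in\mathbb F$; fix such an ordering and $a$. $V_i$ is the $\theta_i$-eigenspace of $A$ and $E_i\in\mathrm{End}(V)$ is the projection onto $V_i$ along $\bigoplus_{j\ne i}V_j$; one has $A^*V_i\subseteq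 V_{i-1}+V_i+V_{i+1}$ ($V_{-1}=V_{d+1}=0$). Lusztig automorphism. $L$ is the automorphism of $\mathcal O_q$ with $L(A)=A$, $L(A^* )=A^*+\frac{[A,[A,A^*]_q]}{(q-q^{-1})(q^2-q^{-2})}$; its inverse satisfies $L^{-1}(A)=A$, $L^{-1}(A^* )=A^*+\frac{[A,[A,A^*]_{q^{-1}}]}{(q-q^{-1})(q^2-q^{-2})}$. The map $H$. Let $t_{ij}=1+\frac{\theta_i-\theta_j}{q-q^{-1}}\cdot\frac{q\theta_i-q^{-1}\theta_j}{q^2-q^{-2}}$, $t_i=t_{01}t_{12}\cdots t_{i-1,i}$ ($t_0=1$), and $H=\sum_{i=0}^d t_iE_i\in\mathrm{End}(V)$; each $t_i\neq0$, so $H$ is invertible. Twisting. For an automorphism $\sigma$ of an algebra $\mathcal A$ and an $\mathcal A$-module $W$, "$W$ twisted via $\sigma$" is the $\mathcal A$-module structure on the vector space $W$ in which $\xi\in\mathcal A$ acts on $w\in W$ as $\sigma^{-1}(\xi).w$ computed in the original module $W$. An isomorphism of $\mathcal A$-modules $W\to W'$ is an $\mathbb F$-linear bijection $\gamma$ with $\xi\gamma=\gamma\xi$ on $W$ for all $\xi\in\mathcal A$. *)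

theory Defs
  imports Complex_Main "HOL-Algebra.QuotRing" "HOL-Algebra.Module" "HOL-Library.Poly_Mapping"
begin

section \<open>Associative unital algebras over a field and their modules\<close>

text \<open>
  The scalars are a type of class \<^class>\<open>field\<close>; an algebra is a HOL-Algebra record, because the
  q-Onsager algebra is a quotient depending on the value q. The locale \<open>algebra\<close> of HOL-Algebra
  covers commutative algebras only.
\<close>

locale assoc_algebra = ring R for R :: "('f::field, 'a) module" (structure) +
  assumes smult_closed: "x \<in> carrier R \<Longrightarrow> c \<odot> x \<in> carrier R"
    and smult_l_distr: "x \<in> carrier R \<Longrightarrow> (b + c) \<odot> x = b \<odot> x \<oplus> c \<odot> x"
    and smult_r_distr: "x \<in> carrier R \<Longrightarrow> y \<in> carrier R \<Longrightarrow> c \<odot> (x \<oplus> y) = c \<odot> x \<oplus> c \<odot> y"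
    and smult_assoc: "x \<in> carrier R \<Longrightarrow> (b * c) \<odot> x = b \<odot> (c \<odot> x)"
    and smult_one: "x \<in> carrier R \<Longrightarrow> 1 \<odot> x = x"
    and smult_mult_left: "x \<in> carrier R \<Longrightarrow> y \<in> carrier R \<Longrightarrow> (c \<odot> x) \<otimes> y = c \<odot> (x \<otimes> y)"
    and smult_mult_right: "x \<in> carrier R \<Longrightarrow> y \<in> carrier R \<Longrightarrow> x \<otimes> (c \<odot> y) = c \<odot> (x \<otimes> y)"

definition algebra_aut :: "('f::field, 'a) module \<Rightarrow> ('a \<Rightarrow> 'a) set" where
  "algebra_aut R = {\<sigma> \<in> ring_iso R R. \<forall>c. \<forall>x \<in> carrier R. \<sigma> (c \<odot>\<^bsub>R\<^esub> x) = c \<odot>\<^bsub>R\<^esub> \<sigma> x}"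

text \<open>The underlying space of a module is a whole type; \<open>act x v\<close> is the vector x.v.\<close>

locale algebra_module =
  assoc_algebra R + vector_space scale
  for R :: "('f::field, 'a) module" (structure) and scale :: "'f \<Rightarrow> 'v::ab_group_add \<Rightarrow> 'v" +
  fixes act :: "'a \<Rightarrow> 'v \<Rightarrow> 'v"
  assumes act_linear: "x \<in> carrier R \<Longrightarrow> Vector_Spaces.linear scale scale (act x)"
    and act_add: "x \<in> carrier R \<Longrightarrow> y \<in> carrier R \<Longrightarrow> act (x \<oplus> y) v = act x v + act y v"
    and act_smult: "x \<in> carrier R \<Longrightarrow> act (c \<odot> x) v = scale c (act x v)"
    and act_mult: "x \<in> carrier R \<Longrightarrow> y \<in> carrier R \<Longrightarrow> act (x \<otimes> y) v = act x (act y v)"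
    and act_one: "act \<one> v = v"

definition irreducible_module ::
  "('f::field, 'a) module \<Rightarrow> ('f \<Rightarrow> 'v::ab_group_add \<Rightarrow> 'v) \<Rightarrow> ('a \<Rightarrow> 'v \<Rightarrow> 'v) \<Rightarrow> bool" where
  "irreducible_module R scale act \<longleftrightarrow>
     algebra_module R scale act \<and> (UNIV :: 'v set) \<noteq> {0} \<and>
     (\<forall>W. module.subspace scale W \<and> (\<forall>x \<in> carrier R. act x ` W \<subseteq> W) \<longrightarrow> W = {0} \<or> W = UNIV)"

definition module_iso ::
  "('f::field, 'a) module
    \<Rightarrow> ('f \<Rightarrow> 'v::ab_group_add \<Rightarrow> 'v) \<Rightarrow> ('a \<Rightarrow> 'v \<Rightarrow> 'v)
    \<Rightarrow> ('f \<Rightarrow> 'w::ab_group_add \<Rightarrow> 'w) \<Rightarrow> ('a \<Rightarrow> 'w \<Rightarrow> 'w) \<Rightarrow> ('v \<Rightarrow> 'w) \<Rightarrow> bool" where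
  "module_iso R scale act scale' act' \<gamma> \<longleftrightarrow>
     algebra_module R scale act \<and> algebra_module R scale' act' \<and>
     Vector_Spaces.linear scale scale' \<gamma> \<and> bij \<gamma> \<and>
     (\<forall>x \<in> carrier R. \<forall>v. act' x (\<gamma> v) = \<gamma> (act x v))"

definition isomorphic_modules ::
  "('f::field, 'a) module
    \<Rightarrow> ('f \<Rightarrow> 'v::ab_group_add \<Rightarrow> 'v) \<Rightarrow> ('a \<Rightarrow> 'v \<Rightarrow> 'v)
    \<Rightarrow> ('f \<Rightarrow> 'w::ab_group_add \<Rightarrow> 'w) \<Rightarrow> ('a \<Rightarrow> 'w \<Rightarrow> 'w) \<Rightarrow> bool" where
  "isomorphic_modules R scale act scale' act' \<longleftrightarrow> (\<exists>\<gamma>. module_iso R scale act scale' act' \<gamma>)"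

definition alg_inv :: "('f::field, 'a) module \<Rightarrow> ('a \<Rightarrow> 'a) \<Rightarrow> 'a \<Rightarrow> 'a" where
  "alg_inv R \<sigma> = inv_into (carrier R) \<sigma>"

definition twist :: "('f::field, 'a) module \<Rightarrow> ('a \<Rightarrow> 'a) \<Rightarrow> ('a \<Rightarrow> 'v \<Rightarrow> 'v) \<Rightarrow> 'a \<Rightarrow> 'v \<Rightarrow> 'v" where
  "twist R \<sigma> act = (\<lambda>x. act (alg_inv R \<sigma> x))"


section \<open>The q-Onsager algebra\<close>

text \<open>
  The free algebra on a type of letters is the monoid algebra of the free monoid: finitely supported
  functions on words, with the convolution product of \<^theory>\<open>HOL-Library.Poly_Mapping\<close>. That product
  uses the additive notation for the monoid, so concatenation of words is written \<open>+\<close>.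
\<close>

datatype 'g word = Word (letters: "'g list")

instantiation word :: (type) monoid_add
begin

definition zero_word :: "'a word" where "0 = Word []"

definition plus_word :: "'a word \<Rightarrow> 'a word \<Rightarrow> 'a word" where
  "u + v = Word (letters u @ letters v)"

instance
  by standard (simp_all add: zero_word_def plus_word_def)

end

definition free_algebra :: "('f::field, 'g word \<Rightarrow>\<^sub>0 'f) module" where
  "free_algebra =
     \<lparr>carrier = UNIV, mult = (*), one = 1, zero = 0, add = (+),
      smult = (\<lambda>c x. Poly_Mapping.single 0 c * x)\<rparr>"

definition letter :: "'g \<Rightarrow> ('g word \<Rightarrow>\<^sub>0 'f::field)" where
  "letter g = Poly_Mapping.single (Word [g]) 1"

text \<open>The scalar c acts on the quotient as multiplication by the coset of \<open>c \<odot> \<one>\<close>.\<close>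

definition quot_algebra :: "('f::field, 'a) module \<Rightarrow> 'a set \<Rightarrow> ('f, 'a set) module" where
  "quot_algebra R I =
     \<lparr>carrier = carrier (R Quot I), mult = mult (R Quot I), one = one (R Quot I),
      zero = zero (R Quot I), add = add (R Quot I),
      smult = (\<lambda>c X. (I +>\<^bsub>R\<^esub> (c \<odot>\<^bsub>R\<^esub> \<one>\<^bsub>R\<^esub>)) \<otimes>\<^bsub>R Quot I\<^esub> X)\<rparr>"

definition comm :: "('f::field, 'a) module \<Rightarrow> 'a \<Rightarrow> 'a \<Rightarrow> 'a" where
  "comm R x y = (x \<otimes>\<^bsub>R\<^esub> y) \<ominus>\<^bsub>R\<^esub> (y \<otimes>\<^bsub>R\<^esub> x)"

definition qcomm :: "('f::field, 'a) module \<Rightarrow> 'f \<Rightarrow> 'a \<Rightarrow> 'a \<Rightarrow> 'a" where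
  "qcomm R q x y = (q \<odot>\<^bsub>R\<^esub> (x \<otimes>\<^bsub>R\<^esub> y)) \<ominus>\<^bsub>R\<^esub> (inverse q \<odot>\<^bsub>R\<^esub> (y \<otimes>\<^bsub>R\<^esub> x))"

text \<open>Left-hand side minus right-hand side of the defining relation with x as outer argument.\<close>

definition onsager_relator :: "('f::field, 'a) module \<Rightarrow> 'f \<Rightarrow> 'a \<Rightarrow> 'a \<Rightarrow> 'a" where
  "onsager_relator R q x y =
     comm R x (qcomm R (inverse q) x (qcomm R q x y))
       \<ominus>\<^bsub>R\<^esub> ((q\<^sup>2 - (inverse q)\<^sup>2)\<^sup>2 \<odot>\<^bsub>R\<^esub> comm R y x)"

datatype onsager_gen = Gen_A | Gen_Astar

type_synonym 'f onsager = "(onsager_gen word \<Rightarrow>\<^sub>0 'f) set"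

definition onsager_ideal :: "'f::field \<Rightarrow> (onsager_gen word \<Rightarrow>\<^sub>0 'f) set" where
  "onsager_ideal q =
     Idl\<^bsub>free_algebra\<^esub> {onsager_relator free_algebra q (letter Gen_A) (letter Gen_Astar),
                        onsager_relator free_algebra q (letter Gen_Astar) (letter Gen_A)}"

definition q_onsager :: "'f::field \<Rightarrow> ('f, 'f onsager) module" where
  "q_onsager q = quot_algebra free_algebra (onsager_ideal q)"

definition gen_A :: "'f::field \<Rightarrow> 'f onsager" where
  "gen_A q = onsager_ideal q +>\<^bsub>free_algebra\<^esub> letter Gen_A"

definition gen_Astar :: "'f::field \<Rightarrow> 'f onsager" where
  "gen_Astar q = onsager_ideal q +>\<^bsub>free_algebra\<^esub> letter Gen_Astar"

subsection \<open>The construction is an algebra in which the defining relations hold\<close>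

lemma free_algebra_simps [simp]:
  "carrier free_algebra = UNIV" "x \<otimes>\<^bsub>free_algebra\<^esub> y = x * y" "\<one>\<^bsub>free_algebra\<^esub> = 1"
  "\<zero>\<^bsub>free_algebra\<^esub> = 0" "x \<oplus>\<^bsub>free_algebra\<^esub> y = x + y"
  "c \<odot>\<^bsub>free_algebra\<^esub> x = Poly_Mapping.single 0 c * x"
  by (simp_all add: free_algebra_def)

lemma single_0_commutes: "Poly_Mapping.single 0 c * x = x * Poly_Mapping.single 0 c"
  for x :: "'g word \<Rightarrow>\<^sub>0 'f::field"
proof (induction x rule: update_induct)
  case const
  show ?case by simp
next
  case (update f a b)
  have "Poly_Mapping.update a b f = Poly_Mapping.single a b + f"
    using update(1)
    by (intro poly_mapping_eqI) (auto simp: lookup_update lookup_add lookup_single in_keys_iff when_def)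
  with update(3) show ?case
    by (simp add: distrib_left distrib_right mult_single mult.commute)
qed

lemma ring_free_algebra: "ring (free_algebra :: ('f::field, 'g word \<Rightarrow>\<^sub>0 'f) module)"
proof (rule ringI)
  show "abelian_group (free_algebra :: ('f, 'g word \<Rightarrow>\<^sub>0 'f) module)"
  proof (rule abelian_groupI)
    fix x :: "'g word \<Rightarrow>\<^sub>0 'f"
    show "\<exists>y\<in>carrier free_algebra. y \<oplus>\<^bsub>free_algebra\<^esub> x = \<zero>\<^bsub>free_algebra\<^esub>"
      by (auto intro!: exI[of _ "- x"])
  qed (auto simp: ac_simps)
  show "Group.monoid (free_algebra :: ('f, 'g word \<Rightarrow>\<^sub>0 'f) module)"
    by (rule monoidI) (auto simp: mult.assoc)
qed (auto simp: distrib_left distrib_right)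

lemma assoc_algebra_free_algebra:
  "assoc_algebra (free_algebra :: ('f::field, 'g word \<Rightarrow>\<^sub>0 'f) module)"
proof (intro assoc_algebra.intro assoc_algebra_axioms.intro ring_free_algebra)
  fix c :: 'f and x y :: "'g word \<Rightarrow>\<^sub>0 'f"
  show "x \<otimes>\<^bsub>free_algebra\<^esub> (c \<odot>\<^bsub>free_algebra\<^esub> y) = c \<odot>\<^bsub>free_algebra\<^esub> (x \<otimes>\<^bsub>free_algebra\<^esub> y)"
    by (simp add: mult.assoc[symmetric] single_0_commutes[of c x])
qed (auto simp: distrib_left distrib_right single_add mult.assoc mult_single
       simp flip: mult.assoc)

lemma assoc_algebra_quot_algebra:
  assumes "assoc_algebra R" "ideal I R"
  shows "assoc_algebra (quot_algebra R I)"
proof -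
  interpret R: assoc_algebra R by fact
  interpret I: ideal I R by fact
  let ?Q = "quot_algebra R I"
  interpret Q: ring "R Quot I" by (rule I.quotient_is_ring)
  have sel: "carrier ?Q = carrier (R Quot I)" "mult ?Q = mult (R Quot I)" "one ?Q = one (R Quot I)"
      "zero ?Q = zero (R Quot I)" "add ?Q = add (R Quot I)"
    by (simp_all add: quot_algebra_def)
  have ring: "ring ?Q"
  proof (rule ringI)
    show "abelian_group ?Q"
    proof (rule abelian_groupI)
      fix X assume "X \<in> carrier ?Q"
      then show "\<exists>Y \<in> carrier ?Q. Y \<oplus>\<^bsub>?Q\<^esub> X = \<zero>\<^bsub>?Q\<^esub>"
        unfolding sel using Q.l_neg Q.a_inv_closed by blast
    qed (auto simp: sel Q.a_ac)
    show "Group.monoid ?Q"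
      by (rule monoidI) (auto simp: sel Q.m_assoc)
  qed (auto simp: sel Q.l_distr Q.r_distr)
  have ex: "\<exists>x \<in> carrier R. X = I +>\<^bsub>R\<^esub> x" if "X \<in> carrier ?Q" for X
    using that by (auto simp: sel FactRing_simps)
  have cl: "I +>\<^bsub>R\<^esub> x \<in> carrier ?Q" if "x \<in> carrier R" for x
    using that by (auto simp: sel FactRing_simps)
  have m: "(I +>\<^bsub>R\<^esub> x) \<otimes>\<^bsub>?Q\<^esub> (I +>\<^bsub>R\<^esub> y) = I +>\<^bsub>R\<^esub> (x \<otimes>\<^bsub>R\<^esub> y)"
    if "x \<in> carrier R" "y \<in> carrier R" for x y
    using that by (simp add: sel FactRing_def I.rcoset_mult_add)
  have a: "(I +>\<^bsub>R\<^esub> x) \<oplus>\<^bsub>?Q\<^esub> (I +>\<^bsub>R\<^esub> y) = I +>\<^bsub>R\<^esub> (x \<oplus>\<^bsub>R\<^esub> y)"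
    if "x \<in> carrier R" "y \<in> carrier R" for x y
    using that by (simp add: sel FactRing_def I.a_rcos_sum)
  have s: "c \<odot>\<^bsub>?Q\<^esub> (I +>\<^bsub>R\<^esub> x) = I +>\<^bsub>R\<^esub> (c \<odot>\<^bsub>R\<^esub> x)" if "x \<in> carrier R" for c x
    using that m[of "c \<odot>\<^bsub>R\<^esub> \<one>\<^bsub>R\<^esub>" x]
    by (simp add: quot_algebra_def R.smult_closed R.smult_mult_left)
  show ?thesis
    by (intro assoc_algebra.intro assoc_algebra_axioms.intro ring)
       (auto dest!: ex simp: m a s cl R.smult_closed R.smult_l_distr R.smult_r_distr R.smult_assoc
         R.smult_one R.smult_mult_left R.smult_mult_right)
qed

lemma ideal_onsager_ideal: "ideal (onsager_ideal q) free_algebra"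
  unfolding onsager_ideal_def by (rule ring.genideal_ideal[OF ring_free_algebra]) simp

lemma assoc_algebra_q_onsager: "assoc_algebra (q_onsager q)"
  unfolding q_onsager_def
  by (intro assoc_algebra_quot_algebra assoc_algebra_free_algebra ideal_onsager_ideal)

lemma gen_A_carrier: "gen_A q \<in> carrier (q_onsager q)"
  and gen_Astar_carrier: "gen_Astar q \<in> carrier (q_onsager q)"
  by (auto simp: gen_A_def gen_Astar_def q_onsager_def quot_algebra_def FactRing_def A_RCOSETS_def'
      a_r_coset_def)

lemma quot_algebra_hom:
  assumes "assoc_algebra R" "ideal I R"
  shows "ring_hom_ring R (quot_algebra R I) (\<lambda>x. I +>\<^bsub>R\<^esub> x)"
    and "x \<in> carrier R \<Longrightarrow> I +>\<^bsub>R\<^esub> (c \<odot>\<^bsub>R\<^esub> x) = c \<odot>\<^bsub>quot_algebra R I\<^esub> (I +>\<^bsub>R\<^esub> x)"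
proof -
  interpret R: assoc_algebra R by fact
  interpret I: ideal I R by fact
  interpret Q: assoc_algebra "quot_algebra R I" by (intro assoc_algebra_quot_algebra assms)
  have "(\<lambda>x. I +>\<^bsub>R\<^esub> x) \<in> ring_hom R (quot_algebra R I)"
    using I.rcos_ring_hom by (simp add: ring_hom_def quot_algebra_def)
  then show "ring_hom_ring R (quot_algebra R I) (\<lambda>x. I +>\<^bsub>R\<^esub> x)"
    by (intro ring_hom_ringI2 R.ring_axioms Q.ring_axioms)
  show "I +>\<^bsub>R\<^esub> (c \<odot>\<^bsub>R\<^esub> x) = c \<odot>\<^bsub>quot_algebra R I\<^esub> (I +>\<^bsub>R\<^esub> x)" if "x \<in> carrier R"
    using that I.rcoset_mult_add[of "c \<odot>\<^bsub>R\<^esub> \<one>\<^bsub>R\<^esub>" x]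
    by (simp add: quot_algebra_def FactRing_def R.smult_closed R.smult_mult_left)
qed

lemma quot_algebra_onsager_relator:
  assumes "assoc_algebra R" "ideal I R" "x \<in> carrier R" "y \<in> carrier R"
  shows "onsager_relator (quot_algebra R I) q (I +>\<^bsub>R\<^esub> x) (I +>\<^bsub>R\<^esub> y)
           = I +>\<^bsub>R\<^esub> onsager_relator R q x y"
proof -
  interpret R: assoc_algebra R by fact
  interpret h: ring_hom_ring R "quot_algebra R I" "\<lambda>x. I +>\<^bsub>R\<^esub> x"
    by (rule quot_algebra_hom(1)[OF assms(1,2)])
  show ?thesis
    using assms(3,4)
    by (simp add: onsager_relator_def comm_def qcomm_def a_minus_def R.smult_closed
        flip: quot_algebra_hom(2)[OF assms(1,2)] h.hom_mult h.hom_add h.hom_a_inv)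
qed

lemma q_onsager_relations:
  "onsager_relator (q_onsager q) q (gen_A q) (gen_Astar q) = \<zero>\<^bsub>q_onsager q\<^esub>"
  "onsager_relator (q_onsager q) q (gen_Astar q) (gen_A q) = \<zero>\<^bsub>q_onsager q\<^esub>"
proof -
  interpret I: ideal "onsager_ideal q" free_algebra by (rule ideal_onsager_ideal)
  have "onsager_relator free_algebra q (letter Gen_A) (letter Gen_Astar) \<in> onsager_ideal q"
    "onsager_relator free_algebra q (letter Gen_Astar) (letter Gen_A) \<in> onsager_ideal q"
    by (auto simp: onsager_ideal_def genideal_def)
  then show "onsager_relator (q_onsager q) q (gen_A q) (gen_Astar q) = \<zero>\<^bsub>q_onsager q\<^esub>"
    "onsager_relator (q_onsager q) q (gen_Astar q) (gen_A q) = \<zero>\<^bsub>q_onsager q\<^esub>"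
    by (simp_all add: q_onsager_def gen_A_def gen_Astar_def I.a_rcos_const quot_algebra_onsager_relator
        assoc_algebra_free_algebra ideal_onsager_ideal)
       (simp_all add: quot_algebra_def FactRing_def)
qed

text \<open>
  An automorphism is determined by its values on the generators, so on the carrier there is at most
  one L satisfying this predicate.
\<close>

definition is_lusztig_aut :: "'f::field \<Rightarrow> ('f onsager \<Rightarrow> 'f onsager) \<Rightarrow> bool" where
  "is_lusztig_aut q L \<longleftrightarrow>
     L \<in> algebra_aut (q_onsager q) \<and>
     L (gen_A q) = gen_A q \<and>
     L (gen_Astar q) = gen_Astar q \<oplus>\<^bsub>q_onsager q\<^esub>
       (inverse ((q - inverse q) * (q\<^sup>2 - (inverse q)\<^sup>2)) \<odot>\<^bsub>q_onsager q\<^esub>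
         comm (q_onsager q) (gen_A q) (qcomm (q_onsager q) q (gen_A q) (gen_Astar q)))"


section \<open>Eigenspaces and the map H\<close>

definition eigenspace :: "('f::field \<Rightarrow> 'v::ab_group_add \<Rightarrow> 'v) \<Rightarrow> ('v \<Rightarrow> 'v) \<Rightarrow> 'f \<Rightarrow> 'v set" where
  "eigenspace scale T c = {v. T v = scale c v}"

definition eigenvalues :: "('f::field \<Rightarrow> 'v::ab_group_add \<Rightarrow> 'v) \<Rightarrow> ('v \<Rightarrow> 'v) \<Rightarrow> 'f set" where
  "eigenvalues scale T = {c. \<exists>v. v \<noteq> 0 \<and> T v = scale c v}"

definition diagonalizable :: "('f::field \<Rightarrow> 'v::ab_group_add \<Rightarrow> 'v) \<Rightarrow> ('v \<Rightarrow> 'v) \<Rightarrow> bool" where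
  "diagonalizable scale T \<longleftrightarrow>
     (\<exists>B. \<not> module.dependent scale B \<and> module.span scale B = UNIV \<and>
          (\<forall>v \<in> B. \<exists>c. T v = scale c v))"

text \<open>Projection onto U along W; meaningful when the space is the direct sum of U and W.\<close>

definition projection_along :: "'v::ab_group_add set \<Rightarrow> 'v set \<Rightarrow> 'v \<Rightarrow> 'v" where
  "projection_along U W v = (THE u. u \<in> U \<and> v - u \<in> W)"

definition eigenprojection ::
  "('f::field \<Rightarrow> 'v::ab_group_add \<Rightarrow> 'v) \<Rightarrow> ('v \<Rightarrow> 'v) \<Rightarrow> nat \<Rightarrow> (nat \<Rightarrow> 'f) \<Rightarrow> nat \<Rightarrow> 'v \<Rightarrow> 'v" where
  "eigenprojection scale T d \<theta> i =
     projection_along (eigenspace scale T (\<theta> i))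
       (module.span scale (\<Union>j \<in> {0..d} - {i}. eigenspace scale T (\<theta> j)))"

definition t_pair :: "'f::field \<Rightarrow> (nat \<Rightarrow> 'f) \<Rightarrow> nat \<Rightarrow> nat \<Rightarrow> 'f" where
  "t_pair q \<theta> i j =
     1 + (\<theta> i - \<theta> j) / (q - inverse q) * ((q * \<theta> i - inverse q * \<theta> j) / (q\<^sup>2 - (inverse q)\<^sup>2))"

definition t_coeff :: "'f::field \<Rightarrow> (nat \<Rightarrow> 'f) \<Rightarrow> nat \<Rightarrow> 'f" where
  "t_coeff q \<theta> i = (\<Prod>k<i. t_pair q \<theta> k (Suc k))"

definition H_map ::
  "('f::field \<Rightarrow> 'v::ab_group_add \<Rightarrow> 'v) \<Rightarrow> 'f \<Rightarrow> ('v \<Rightarrow> 'v) \<Rightarrow> nat \<Rightarrow> (nat \<Rightarrow> 'f) \<Rightarrow> 'v \<Rightarrow> 'v" where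
  "H_map scale q T d \<theta> v = (\<Sum>i = 0..d. scale (t_coeff q \<theta> i) (eigenprojection scale T d \<theta> i v))"

end

theory Submission
  imports Defs
begin

text \<open>
  Being an isomorphism to the twisted module is a statement about the two generators only. Since
  \<open>\<xi>\<close> acts on the twist of \<open>V\<close> via \<open>L\<inverse>\<close> as \<open>L(\<xi>)\<close>, the map \<open>H\<close> is an isomorphism from that
  twist to \<open>V\<close> as soon as it is bijective and satisfies \<open>A H = H A\<close> and \<open>A* H = H L(A*)\<close>. Twisting
  both sides once more via \<open>L\<close> gives the isomorphism from \<open>V\<close> to its twist via \<open>L\<close>, and the remaining
  isomorphism is a composition.

  The first equation holds because \<open>H\<close> is a scalar \<open>t\<^sub>i\<close> on each eigenspace \<open>V\<^sub>i\<close> of \<open>A\<close>. For the second,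
  take \<open>v\<close> in \<open>V\<^sub>j\<close> and let \<open>w\<^sub>i\<close> be the component of \<open>A* v\<close> in \<open>V\<^sub>i\<close>. A (\<open>q\<close>-)commutator with \<open>A\<close>
  multiplies \<open>w\<^sub>i\<close> by a scalar depending on \<open>\<theta>\<^sub>i\<close> and \<open>\<theta>\<^sub>j\<close>. So \<open>L(A*) v\<close> has components
  \<open>t\<^sub>i\<^sub>j w\<^sub>i\<close> (\<open>act_lusztig_Astar\<close>), and the equation becomes \<open>t\<^sub>i t\<^sub>i\<^sub>j w\<^sub>i = t\<^sub>j w\<^sub>i\<close> for all \<open>i\<close>.

  The same computation applied to the first defining relation shows that \<open>w\<^sub>i\<close> is annihilated by
  \<open>\<theta>\<^sub>i - \<theta>\<^sub>j\<close> times a quadratic polynomial in \<open>\<theta>\<^sub>i\<close>, \<open>\<theta>\<^sub>j\<close>. For the given eigenvalues that polynomial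
  factors completely, and it vanishes at a pair of distinct indices only if they are neighbours
  (\<open>relation_polynomial_nonzero\<close>). So \<open>w\<^sub>i = 0\<close> unless \<open>\<bar>i - j\<bar> \<le> 1\<close> (\<open>Astar_tridiagonal\<close>). For
  neighbouring indices \<open>t\<^sub>i t\<^sub>i\<^sub>j = t\<^sub>j\<close> (\<open>t_coeff_intertwines\<close>): going up this is the definition of the
  partial products \<open>t\<^sub>i\<close>, and going down it is the identity \<open>t\<^sub>i\<^sub>j t\<^sub>j\<^sub>i = 1\<close>, since the two factors
  are \<open>(x / q)\<^sup>2\<close> and \<open>(q / x)\<^sup>2\<close> when \<open>\<theta>\<^sub>i = x + x\<inverse>\<close>. These values also show
  \<open>t\<^sub>i \<noteq> 0\<close>, which makes \<open>H\<close> bijective.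
\<close>

section \<open>Arithmetic of the eigenvalues\<close>

text \<open>
  The denominators of \<open>t\<^sub>i\<^sub>j\<close> cancel: one of the factors \<open>q - q\<inverse>\<close>, \<open>q\<^sup>2 - q\<^sup>-\<^sup>2\<close> splits off from each
  numerator, which leaves \<open>1 + (x/q - q/x) x/q\<close> for the pair \<open>(i, j)\<close> and \<open>1 - (x/q - q/x) q/x\<close> for
  the reversed pair.
\<close>
lemma t_pair_of_ladder:
  fixes x q :: "'f::field"
  assumes "x \<noteq> 0" "q \<noteq> 0" "q\<^sup>2 \<noteq> 1" "q ^ 4 \<noteq> 1"
    and i: "\<theta> i = x + inverse x" and j: "\<theta> j = x / q\<^sup>2 + q\<^sup>2 / x"
  shows "t_pair q \<theta> i j = x\<^sup>2 / q\<^sup>2" and "t_pair q \<theta> j i = q\<^sup>2 / x\<^sup>2"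
proof -
  have q1: "q - inverse q \<noteq> 0"
    using assms(2,3) by (auto simp: field_simps power2_eq_square)
  have q2: "q\<^sup>2 - (inverse q)\<^sup>2 \<noteq> 0"
  proof
    assume "q\<^sup>2 - (inverse q)\<^sup>2 = 0"
    then have "q\<^sup>2 * q\<^sup>2 = (inverse q)\<^sup>2 * q\<^sup>2" by simp
    with assms(2,4) show False by (simp add: power2_eq_square eval_nat_numeral mult.assoc)
  qed
  have "\<theta> i - \<theta> j = (q - inverse q) * (x / q - q / x)"
    "\<theta> j - \<theta> i = (q - inverse q) * (q / x - x / q)"
    unfolding i j using assms(1,2) by (simp_all add: field_simps power2_eq_square)
  then have diff: "(\<theta> i - \<theta> j) / (q - inverse q) = x / q - q / x"
    "(\<theta> j - \<theta> i) / (q - inverse q) = q / x - x / q"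
    using q1 by simp_all
  have "q * \<theta> i - inverse q * \<theta> j = (q\<^sup>2 - (inverse q)\<^sup>2) * (x / q)"
    unfolding i j using assms(1,2) by (simp add: field_simps power2_eq_square)
  then have up: "(q * \<theta> i - inverse q * \<theta> j) / (q\<^sup>2 - (inverse q)\<^sup>2) = x / q"
    using q2 by simp
  have "q * \<theta> j - inverse q * \<theta> i = (q\<^sup>2 - (inverse q)\<^sup>2) * (q / x)"
    unfolding i j using assms(1,2) by (simp add: field_simps power2_eq_square)
  then have down: "(q * \<theta> j - inverse q * \<theta> i) / (q\<^sup>2 - (inverse q)\<^sup>2) = q / x"
    using q2 by simp
  show "t_pair q \<theta> i j = x\<^sup>2 / q\<^sup>2"
    unfolding t_pair_def diff up using assms(1,2) by (simp add: field_simps power2_eq_square)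
  show "t_pair q \<theta> j i = q\<^sup>2 / x\<^sup>2"
    unfolding t_pair_def diff down using assms(1,2) by (simp add: field_simps power2_eq_square)
qed

text \<open>
  The eigenvalue of the first defining relation on a map from the \<open>r\<close>- to the \<open>s\<close>-eigenspace of \<open>A\<close>,
  up to the factor \<open>s - r\<close>. As a polynomial in \<open>r\<close> it has the two roots
  \<open>q\<^sup>2 x + (q\<^sup>2 x)\<inverse>\<close> and \<open>q\<^sup>-\<^sup>2 x + (q\<^sup>-\<^sup>2 x)\<inverse>\<close>, and each root splits
  into two linear factors in \<open>y\<close>.
\<close>
lemma relation_polynomial_factorization:
  fixes x y q :: "'f::field"
  assumes "x \<noteq> 0" "y \<noteq> 0" "q \<noteq> 0"
  defines "s \<equiv> x + inverse x" and "r \<equiv> y + inverse y"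
  shows "(inverse q * s - q * r) * (q * s - inverse q * r) + (q\<^sup>2 - (inverse q)\<^sup>2)\<^sup>2
      = (x / y - q\<^sup>2) * (y / x - q\<^sup>2) * (x * y - q\<^sup>2) * (inverse (x * y) - q\<^sup>2) / q ^ 4"
  unfolding s_def r_def using assms(1-3)
  by (simp add: field_simps power2_eq_square eval_nat_numeral)

locale onsager_eigenvalues =
  fixes q a :: "'f::field" and d :: nat and \<theta> :: "nat \<Rightarrow> 'f"
  assumes q_nonzero: "q \<noteq> 0"
    and q_not_root_of_unity: "n > 0 \<Longrightarrow> q ^ n \<noteq> 1"
    and a_nonzero: "a \<noteq> 0"
    and inj: "inj_on \<theta> {0..d}"
    and eigenvalue: "i \<le> d \<Longrightarrow>
      \<theta> i = a * q powi (int d - 2 * int i) + inverse a * q powi (2 * int i - int d)"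
begin

text \<open>A parameter \<open>x\<^sub>i\<close> with \<open>\<theta>\<^sub>i = x\<^sub>i + x\<^sub>i\<inverse>\<close>; unlike \<open>\<theta>\<^sub>i\<close> it is a geometric sequence in \<open>i\<close>.\<close>
definition ladder :: "nat \<Rightarrow> 'f" where
  "ladder i = a * q powi (int d - 2 * int i)"

lemma ladder_nonzero: "ladder i \<noteq> 0"
  by (simp add: ladder_def a_nonzero q_nonzero)

lemma eigenvalue_ladder: "i \<le> d \<Longrightarrow> \<theta> i = ladder i + inverse (ladder i)"
  by (simp add: eigenvalue ladder_def power_int_minus[symmetric])

lemma ladder_Suc: "ladder (Suc i) = ladder i / q\<^sup>2"
proof -
  have "int d - 2 * int (Suc i) = (int d - 2 * int i) - 2" by simp
  then have "q powi (int d - 2 * int (Suc i)) = q powi (int d - 2 * int i) / q powi 2"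
    by (simp only: power_int_diff[OF disjI1[OF q_nonzero]])
  then show ?thesis by (simp add: ladder_def)
qed

lemma ladder_times_power: "ladder i * q ^ (2 * i) = a * q powi int d"
proof (induction i)
  case (Suc i)
  have "ladder (Suc i) * q ^ (2 * Suc i) = ladder i * q ^ (2 * i)"
    by (simp add: ladder_Suc power2_eq_square q_nonzero)
  then show ?case using Suc by simp
qed (simp add: ladder_def)

lemma ladder_eq_iff: "ladder i = ladder j * q ^ (2 * k) \<longleftrightarrow> j = i + k"
proof
  assume h: "ladder i = ladder j * q ^ (2 * k)"
  have "ladder i * q ^ (2 * i) = ladder j * q ^ (2 * j)"
    by (simp only: ladder_times_power)
  with h have "q ^ (2 * k + 2 * i) = q ^ (2 * j)"
    using ladder_nonzero[of j] by (simp add: power_add mult.assoc)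
  moreover have "m = n" if "q ^ m = q ^ n" for m n
  proof -
    have False if "q ^ m = q ^ n" "m < n" for m n
    proof -
      have "q ^ n = q ^ m * q ^ (n - m)" using that(2) by (simp flip: power_add)
      with that q_nonzero q_not_root_of_unity[of "n - m"] show False by simp
    qed
    from this[of m n] this[of n m] that show ?thesis by (metis linorder_neqE_nat)
  qed
  ultimately show "j = i + k" by fastforce
next
  assume "j = i + k"
  moreover have "ladder i * q ^ (2 * i) = ladder (i + k) * q ^ (2 * (i + k))"
    by (simp only: ladder_times_power)
  ultimately show "ladder i = ladder j * q ^ (2 * k)"
    using q_nonzero by (simp add: power_add distrib_left mult_ac)
qed

lemma ladder_prod_ne_1:
  assumes "i \<le> d" "j \<le> d" "i \<noteq> j"
  shows "ladder i * ladder j \<noteq> 1"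
proof
  assume "ladder i * ladder j = 1"
  then have "inverse (ladder i) = ladder j" "inverse (ladder j) = ladder i"
    by (simp_all add: inverse_unique mult.commute)
  then have "\<theta> i = \<theta> j"
    using assms by (auto simp: eigenvalue_ladder)
  with assms inj show False by (auto simp: inj_on_def)
qed

text \<open>
  The first two factors vanish only for neighbours, because \<open>q\<close> is not a root of unity. If one of the
  other two vanishes, then \<open>x\<^sub>i x\<^sub>j = q\<^sup>\<plusminus>\<^sup>2\<close>, and moving one index by a step gives indices \<open>k\<close>, \<open>l\<close> with
  \<open>x\<^sub>k x\<^sub>l = 1\<close>, that is \<open>\<theta>\<^sub>k = \<theta>\<^sub>l\<close>. As \<open>i\<close> and \<open>j\<close> are not neighbours, \<open>k \<noteq> l\<close>, which contradicts
  the injectivity of \<open>\<theta>\<close>.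
\<close>
lemma relation_polynomial_nonzero:
  assumes "i \<le> d" "j \<le> d" "i \<noteq> j" "j \<noteq> Suc i" "i \<noteq> Suc j"
  shows "(inverse q * \<theta> i - q * \<theta> j) * (q * \<theta> i - inverse q * \<theta> j)
           + (q\<^sup>2 - (inverse q)\<^sup>2)\<^sup>2 \<noteq> 0"
proof -
  let ?x = "ladder i" and ?y = "ladder j"
  have ratio: "?x / ?y \<noteq> q\<^sup>2" "?y / ?x \<noteq> q\<^sup>2"
    using ladder_eq_iff[of i j 1] ladder_eq_iff[of j i 1] assms(4,5)
    by (simp_all add: divide_eq_eq ladder_nonzero mult.commute)
  \<comment> \<open>As \<open>i \<noteq> j\<close>, one of the indices is below \<open>d\<close> and can move up; below, one is positive and can move down.\<close>
  have "?x * ?y \<noteq> q\<^sup>2"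
  proof (cases "i < d")
    case True
    then show ?thesis
      using ladder_prod_ne_1[of "Suc i" j] assms q_nonzero by (auto simp: ladder_Suc)
  next
    case False
    then show ?thesis
      using ladder_prod_ne_1[of "Suc j" i] assms q_nonzero
      by (auto simp: ladder_Suc mult.commute)
  qed
  moreover have "inverse (?x * ?y) \<noteq> q\<^sup>2"
  proof -
    have shift: "inverse (ladder (Suc k) * ladder l) \<noteq> q\<^sup>2" if "ladder k * ladder l \<noteq> 1" for k l
      using that q_nonzero ladder_nonzero[of k] ladder_nonzero[of l]
      by (auto simp: ladder_Suc field_simps)
    show ?thesis
    proof (cases i)
      case 0
      then obtain k where k: "j = Suc k" using assms(3) by (cases j) auto
      with 0 assms shift[of k i] ladder_prod_ne_1[of k i] show ?thesis
        by (auto simp: mult.commute)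
    next
      case (Suc k)
      with assms shift[of k j] ladder_prod_ne_1[of k j] show ?thesis by auto
    qed
  qed
  ultimately show ?thesis
    using ratio assms(1,2) q_nonzero
    by (simp add: eigenvalue_ladder relation_polynomial_factorization ladder_nonzero)
qed

lemma t_pair_neighbours:
  assumes "Suc i \<le> d"
  shows "t_pair q \<theta> i (Suc i) = (ladder i)\<^sup>2 / q\<^sup>2"
    and "t_pair q \<theta> (Suc i) i = q\<^sup>2 / (ladder i)\<^sup>2"
proof -
  have "\<theta> i = ladder i + inverse (ladder i)" "\<theta> (Suc i) = ladder i / q\<^sup>2 + q\<^sup>2 / ladder i"
    using assms by (auto simp: eigenvalue_ladder ladder_Suc)
  then show "t_pair q \<theta> i (Suc i) = (ladder i)\<^sup>2 / q\<^sup>2"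
    and "t_pair q \<theta> (Suc i) i = q\<^sup>2 / (ladder i)\<^sup>2"
    using t_pair_of_ladder[of "ladder i" q \<theta> i "Suc i"] ladder_nonzero q_nonzero
      q_not_root_of_unity[of 2] q_not_root_of_unity[of 4] by auto
qed

lemma t_coeff_nonzero: "i \<le> d \<Longrightarrow> t_coeff q \<theta> i \<noteq> 0"
  unfolding t_coeff_def using ladder_nonzero q_nonzero by (simp add: t_pair_neighbours)

text \<open>The scalar form of \<open>A* H = H L(A*)\<close>; the case \<open>i = Suc j\<close> uses \<open>t\<^sub>i\<^sub>j t\<^sub>j\<^sub>i = 1\<close>.\<close>
lemma t_coeff_intertwines:
  assumes "i \<le> d" "j \<le> d" "i = j \<or> j = Suc i \<or> i = Suc j"
  shows "t_coeff q \<theta> i * t_pair q \<theta> i j = t_coeff q \<theta> j"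
proof -
  have Suc: "t_coeff q \<theta> (Suc k) = t_coeff q \<theta> k * t_pair q \<theta> k (Suc k)" for k
    by (simp add: t_coeff_def)
  from assms(3) consider "i = j" | "j = Suc i" | "i = Suc j" by blast
  then show ?thesis
  proof cases
    case 1
    then show ?thesis by (simp add: t_pair_def)
  next
    case 2
    then show ?thesis by (simp add: Suc)
  next
    case 3
    then have "t_pair q \<theta> j (Suc j) * t_pair q \<theta> (Suc j) j = 1"
      using assms(1) by (simp add: t_pair_neighbours ladder_nonzero q_nonzero)
    with 3 show ?thesis by (simp add: Suc mult.assoc)
  qed
qed

end

section \<open>Eigenspace decompositions\<close>

lemma (in vector_space) diagonalizable_span_eigenspaces:
  assumes "diagonalizable scale T" "eigenvalues scale T = \<theta> ` I"
  shows "span (\<Union>i\<in>I. eigenspace scale T (\<theta> i)) = UNIV"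
proof -
  obtain B where B: "\<not> dependent B" "span B = UNIV" "\<forall>v\<in>B. \<exists>c. T v = scale c v"
    using assms(1) by (auto simp: diagonalizable_def)
  have "B \<subseteq> (\<Union>i\<in>I. eigenspace scale T (\<theta> i))"
  proof
    fix v assume v: "v \<in> B"
    then obtain c where c: "T v = scale c v" using B by auto
    have "v \<noteq> 0" using v B(1) dependent_zero by auto
    with c have "c \<in> eigenvalues scale T" by (auto simp: eigenvalues_def)
    with assms(2) c show "v \<in> (\<Union>i\<in>I. eigenspace scale T (\<theta> i))"
      by (auto simp: eigenspace_def)
  qed
  from span_mono[OF this] B(2) show ?thesis by auto
qed

text \<open>
  A vector is handled through the family of its components, one in each eigenspace;
  \<open>eigenprojection_sum\<close> identifies the eigenprojections as the component maps.
\<close>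
locale eigendecomposition = vector_space scale
  for scale :: "'f::field \<Rightarrow> 'v::ab_group_add \<Rightarrow> 'v" +
  fixes T :: "'v \<Rightarrow> 'v" and d :: nat and \<theta> :: "nat \<Rightarrow> 'f"
  assumes linear_op: "Vector_Spaces.linear scale scale T"
    and inj_eigenvalues: "inj_on \<theta> {0..d}"
    and span_eigenspaces: "span (\<Union>i\<in>{0..d}. eigenspace scale T (\<theta> i)) = UNIV"
begin

sublocale op: Vector_Spaces.linear scale scale T
  by (rule linear_op)

abbreviation eigenfamily :: "(nat \<Rightarrow> 'v) \<Rightarrow> bool" where
  "eigenfamily w \<equiv> \<forall>i\<in>{0..d}. w i \<in> eigenspace scale T (\<theta> i)"

lemma subspace_eigenspace: "subspace (eigenspace scale T c)"
  by (rule subspaceI)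
     (auto simp: eigenspace_def op.add op.scale scale_right_distrib scale_left_commute)

text \<open>
  Stated for an arbitrary index set, because the complement of an eigenspace in the definition of the
  eigenprojection is the span over all indices but one.
\<close>
lemma span_eigenspaces_sum:
  assumes "finite I" "v \<in> span (\<Union>i\<in>I. eigenspace scale T (\<theta> i))"
  shows "\<exists>w. (\<forall>i\<in>I. w i \<in> eigenspace scale T (\<theta> i)) \<and> v = (\<Sum>i\<in>I. w i)"
  using assms(2)
proof (induction rule: span_induct_alt)
  case base
  show ?case by (intro exI[of _ "\<lambda>_. 0"]) (auto intro: subspace_0 subspace_eigenspace)
next
  case (step c x y)
  then obtain w j where w: "\<forall>i\<in>I. w i \<in> eigenspace scale T (\<theta> i)" "y = (\<Sum>i\<in>I. w i)"
    and j: "j \<in> I" "x \<in> eigenspace scale T (\<theta> j)" by auto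
  have "scale c x + y = (\<Sum>i\<in>I. (if i = j then scale c x else 0) + w i)"
    using j assms(1) by (simp add: w sum.distrib)
  moreover have "\<forall>i\<in>I. (if i = j then scale c x else 0) + w i \<in> eigenspace scale T (\<theta> i)"
    using w j by (auto intro: subspace_add subspace_scale subspace_eigenspace)
  ultimately show ?case by (intro exI[of _ "\<lambda>i. (if i = j then scale c x else 0) + w i"]) auto
qed

lemma obtain_eigenfamily:
  obtains w where "eigenfamily w" "v = (\<Sum>i=0..d. w i)"
  using span_eigenspaces_sum[of "{0..d}" v] span_eigenspaces by auto

text \<open>
  Applying \<open>T - \<theta>\<^sub>s\<close> to a vanishing sum removes the component \<open>s\<close> and multiplies every other component
  by a nonzero scalar, so induction on the index set applies.
\<close>
lemma eigenvectors_independent: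
  assumes "finite I" "inj_on \<theta> I" "\<forall>i\<in>I. w i \<in> eigenspace scale T (\<theta> i)" "(\<Sum>i\<in>I. w i) = 0"
  shows "\<forall>i\<in>I. w i = 0"
  using assms
proof (induction I arbitrary: w rule: finite_induct)
  case (insert s I)
  define u where "u i = scale (\<theta> i - \<theta> s) (w i)" for i
  have sum: "w s + (\<Sum>i\<in>I. w i) = 0" using insert by simp
  have "(\<Sum>i\<in>I. u i) = (\<Sum>i\<in>I. T (w i)) - scale (\<theta> s) (\<Sum>i\<in>I. w i)"
    using insert.prems by (simp add: u_def scale_left_diff_distrib sum_subtractf scale_sum_right
        eigenspace_def)
  also have "\<dots> = T (w s + (\<Sum>i\<in>I. w i)) - scale (\<theta> s) (w s + (\<Sum>i\<in>I. w i))"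
    using insert.prems by (simp add: op.add op.sum scale_right_distrib eigenspace_def)
  also have "\<dots> = 0" using sum by (simp add: op.zero)
  finally have "(\<Sum>i\<in>I. u i) = 0" .
  moreover have "\<forall>i\<in>I. u i \<in> eigenspace scale T (\<theta> i)"
    using insert.prems by (auto simp: u_def intro: subspace_scale subspace_eigenspace)
  ultimately have "\<forall>i\<in>I. u i = 0" using insert by auto
  moreover have "\<theta> i \<noteq> \<theta> s" if "i \<in> I" for i
    using that insert.prems(1) insert.hyps by (auto simp: inj_on_def)
  ultimately have "\<forall>i\<in>I. w i = 0" by (auto simp: u_def)
  with sum show ?case by simp
qed simp

lemma eigenfamily_sum_eq_0_iff:
  assumes "eigenfamily w"
  shows "(\<Sum>i=0..d. w i) = 0 \<longleftrightarrow> (\<forall>i\<in>{0..d}. w i = 0)"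
  using eigenvectors_independent[OF _ inj_eigenvalues assms] by auto

lemma eigenprojection_sum:
  assumes w: "eigenfamily w" and i: "i \<le> d"
  shows "eigenprojection scale T d \<theta> i (\<Sum>j=0..d. w j) = w i"
  unfolding eigenprojection_def projection_along_def
proof (rule the_equality)
  let ?W = "span (\<Union>j\<in>{0..d} - {i}. eigenspace scale T (\<theta> j))"
  have split: "(\<Sum>j=0..d. f j) = f i + (\<Sum>j\<in>{0..d} - {i}. f j)" for f :: "nat \<Rightarrow> 'v"
    using i by (subst sum.remove[of _ i]) auto
  show "w i \<in> eigenspace scale T (\<theta> i) \<and> (\<Sum>j=0..d. w j) - w i \<in> ?W"
    using w i unfolding split[of w] by (auto intro!: span_sum intro: span_base)
  fix u assume u: "u \<in> eigenspace scale T (\<theta> i) \<and> (\<Sum>j=0..d. w j) - u \<in> ?W"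
  then obtain z where z: "\<forall>j\<in>{0..d} - {i}. z j \<in> eigenspace scale T (\<theta> j)"
    "(\<Sum>j=0..d. w j) - u = (\<Sum>j\<in>{0..d} - {i}. z j)"
    using span_eigenspaces_sum[of "{0..d} - {i}"] by auto
  \<comment> \<open>The two decompositions of the same vector differ by a family of eigenvectors with sum 0.\<close>
  define y where "y j = w j - (if j = i then u else z j)" for j
  have "eigenfamily y"
    using w u z i by (auto simp: y_def intro: subspace_diff subspace_eigenspace)
  moreover have "(\<Sum>j=0..d. y j) = 0"
    using z(2) unfolding split[of y] split[of w]
    by (simp add: y_def sum_subtractf algebra_simps)
  ultimately have "y i = 0" using i by (simp add: eigenfamily_sum_eq_0_iff)
  then show "u = w i" by (simp add: y_def)
qed

lemma H_map_sum:
  assumes "eigenfamily w"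
  shows "H_map scale q T d \<theta> (\<Sum>i=0..d. w i) = (\<Sum>i=0..d. scale (t_coeff q \<theta> i) (w i))"
  unfolding H_map_def using assms by (intro sum.cong) (auto simp: eigenprojection_sum)

lemma H_map_eigenvector:
  assumes "j \<le> d" "v \<in> eigenspace scale T (\<theta> j)"
  shows "H_map scale q T d \<theta> v = scale (t_coeff q \<theta> j) v"
proof -
  have "eigenfamily (\<lambda>i. if i = j then v else 0)"
    using assms by (auto intro: subspace_0 subspace_eigenspace)
  from H_map_sum[OF this, of q] show ?thesis
    using assms(1) by (simp add: if_distrib[of "scale _"] cong: if_cong)
qed

lemma linear_H_map: "Vector_Spaces.linear scale scale (H_map scale q T d \<theta>)"
  unfolding Vector_Spaces.linear_iff
proof (intro conjI allI vector_space_axioms)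
  fix v u c
  obtain w where w: "eigenfamily w" "v = (\<Sum>i=0..d. w i)" by (rule obtain_eigenfamily)
  obtain y where y: "eigenfamily y" "u = (\<Sum>i=0..d. y i)" by (rule obtain_eigenfamily)
  have "eigenfamily (\<lambda>i. w i + y i)" "eigenfamily (\<lambda>i. scale c (w i))"
    using w y by (auto intro: subspace_add subspace_scale subspace_eigenspace)
  note sums = this[THEN H_map_sum, of q]
  show "H_map scale q T d \<theta> (v + u) = H_map scale q T d \<theta> v + H_map scale q T d \<theta> u"
    using sums(1) H_map_sum[OF w(1), of q] H_map_sum[OF y(1), of q]
    by (simp add: w(2) y(2) sum.distrib scale_right_distrib)
  show "H_map scale q T d \<theta> (scale c v) = scale c (H_map scale q T d \<theta> v)"
    using sums(2) H_map_sum[OF w(1), of q]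
    by (simp add: w(2) scale_sum_right mult.commute)
qed

lemma bij_H_map:
  assumes t: "\<And>i. i \<le> d \<Longrightarrow> t_coeff q \<theta> i \<noteq> 0"
  shows "bij (H_map scale q T d \<theta>)"
proof -
  interpret H: Vector_Spaces.linear scale scale "H_map scale q T d \<theta>"
    by (rule linear_H_map)
  have "v = 0" if "H_map scale q T d \<theta> v = 0" for v
  proof -
    obtain w where w: "eigenfamily w" "v = (\<Sum>i=0..d. w i)" by (rule obtain_eigenfamily)
    have "eigenfamily (\<lambda>i. scale (t_coeff q \<theta> i) (w i))"
      using w by (auto intro: subspace_scale subspace_eigenspace)
    from eigenfamily_sum_eq_0_iff[OF this] that t
    have "\<forall>i\<in>{0..d}. w i = 0" by (simp add: w H_map_sum)
    then show ?thesis by (simp add: w(2))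
  qed
  then have "inj (H_map scale q T d \<theta>)" by (simp add: H.inj_iff_eq_0)
  moreover have "v \<in> range (H_map scale q T d \<theta>)" for v
  proof -
    obtain w where w: "eigenfamily w" "v = (\<Sum>i=0..d. w i)" by (rule obtain_eigenfamily)
    have "eigenfamily (\<lambda>i. scale (inverse (t_coeff q \<theta> i)) (w i))"
      using w by (auto intro: subspace_scale subspace_eigenspace)
    from H_map_sum[OF this, of q] t show ?thesis
      by (intro range_eqI[OF sym]) (simp add: w(2))
  qed
  ultimately show ?thesis by (auto simp: bij_def)
qed

lemma linear_eqI_eigenvectors:
  assumes "Vector_Spaces.linear scale s f" "Vector_Spaces.linear scale s g"
    and eq: "\<And>j v. j \<le> d \<Longrightarrow> v \<in> eigenspace scale T (\<theta> j) \<Longrightarrow> f v = g v"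
  shows "f v = g v"
proof -
  interpret f: Vector_Spaces.linear scale s f by fact
  interpret g: Vector_Spaces.linear scale s g by fact
  obtain w where w: "eigenfamily w" "v = (\<Sum>i=0..d. w i)" by (rule obtain_eigenfamily)
  then show ?thesis using eq by (auto simp: f.sum g.sum intro!: sum.cong)
qed

end

section \<open>Modules over algebras and their twists\<close>

lemma alg_inv_aut:
  assumes "assoc_algebra R" "\<sigma> \<in> algebra_aut R"
  shows "alg_inv R \<sigma> \<in> algebra_aut R"
proof -
  interpret assoc_algebra R by fact
  have iso: "\<sigma> \<in> ring_iso R R" and
    smult: "\<And>c x. x \<in> carrier R \<Longrightarrow> \<sigma> (c \<odot>\<^bsub>R\<^esub> x) = c \<odot>\<^bsub>R\<^esub> \<sigma> x"
    using assms(2) by (auto simp: algebra_aut_def)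
  have bij: "bij_betw \<sigma> (carrier R) (carrier R)" by (rule ring_iso_memE(5)[OF iso])
  have "alg_inv R \<sigma> (c \<odot>\<^bsub>R\<^esub> x) = c \<odot>\<^bsub>R\<^esub> alg_inv R \<sigma> x" if x: "x \<in> carrier R" for c x
  proof -
    have y: "alg_inv R \<sigma> x \<in> carrier R" "\<sigma> (alg_inv R \<sigma> x) = x"
      using bij x unfolding alg_inv_def by (auto simp: bij_betw_def inv_into_into f_inv_into_f)
    then have "alg_inv R \<sigma> (c \<odot>\<^bsub>R\<^esub> x) = alg_inv R \<sigma> (\<sigma> (c \<odot>\<^bsub>R\<^esub> alg_inv R \<sigma> x))"
      by (simp add: smult)
    also have "\<dots> = c \<odot>\<^bsub>R\<^esub> alg_inv R \<sigma> x"
      using bij y(1) by (simp add: alg_inv_def bij_betw_def inv_into_f_f smult_closed)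
    finally show ?thesis .
  qed
  moreover have "alg_inv R \<sigma> \<in> ring_iso R R"
    unfolding alg_inv_def by (rule ring_iso_set_sym[OF ring_axioms iso])
  ultimately show ?thesis by (simp add: algebra_aut_def)
qed

lemma
  assumes "\<sigma> \<in> algebra_aut R" "x \<in> carrier R"
  shows aut_alg_inv: "\<sigma> (alg_inv R \<sigma> x) = x"
    and alg_inv_closed: "alg_inv R \<sigma> x \<in> carrier R"
    and aut_closed: "\<sigma> x \<in> carrier R"
    and alg_inv_alg_inv: "alg_inv R (alg_inv R \<sigma>) x = \<sigma> x"
proof -
  have bij: "bij_betw \<sigma> (carrier R) (carrier R)"
    using assms(1) by (auto simp: algebra_aut_def ring_iso_def)
  then show "\<sigma> (alg_inv R \<sigma> x) = x" "alg_inv R \<sigma> x \<in> carrier R" "\<sigma> x \<in> carrier R"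
    "alg_inv R (alg_inv R \<sigma>) x = \<sigma> x"
    using assms(2) inv_into_inv_into_eq[OF bij] unfolding alg_inv_def
    by (auto simp: bij_betw_def inv_into_into f_inv_into_f)
qed

lemma algebra_module_twist:
  assumes "algebra_module R scale act" "\<sigma> \<in> algebra_aut R"
  shows "algebra_module R scale (twist R \<sigma> act)"
proof -
  interpret algebra_module R scale act by fact
  let ?\<tau> = "alg_inv R \<sigma>"
  have "?\<tau> \<in> algebra_aut R" by (rule alg_inv_aut[OF assoc_algebra_axioms assms(2)])
  then have hom: "?\<tau> \<in> ring_hom R R"
    and smult: "\<And>c x. x \<in> carrier R \<Longrightarrow> ?\<tau> (c \<odot>\<^bsub>R\<^esub> x) = c \<odot>\<^bsub>R\<^esub> ?\<tau> x"
    by (auto simp: algebra_aut_def ring_iso_def)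
  note closed = alg_inv_closed[OF assms(2)]
  show ?thesis
    unfolding twist_def
  proof (intro algebra_module.intro algebra_module_axioms.intro
      assoc_algebra_axioms vector_space_axioms)
    fix x assume "x \<in> carrier R"
    then show "Vector_Spaces.linear scale scale (act (?\<tau> x))" by (intro act_linear closed)
  qed (simp_all only: act_add act_smult act_mult act_one closed smult
      ring_hom_add[OF hom] ring_hom_mult[OF hom] ring_hom_one[OF hom])
qed

text \<open>Both module structures are pulled back along the same automorphism, so nothing changes for the map.\<close>
lemma module_iso_twist:
  assumes "module_iso R scale act scale' act' \<gamma>" "\<sigma> \<in> algebra_aut R"
  shows "module_iso R scale (twist R \<sigma> act) scale' (twist R \<sigma> act') \<gamma>"
proof -
  have "algebra_module R scale (twist R \<sigma> act)" "algebra_module R scale' (twist R \<sigma> act')"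
    using assms by (auto simp: module_iso_def intro: algebra_module_twist)
  then show ?thesis
    using assms(1) alg_inv_closed[OF assms(2)] by (simp add: module_iso_def twist_def)
qed

lemma module_iso_cong:
  assumes "module_iso R scale act scale' act' \<gamma>" "algebra_module R scale act2"
    and "\<And>x v. x \<in> carrier R \<Longrightarrow> act2 x v = act x v"
  shows "module_iso R scale act2 scale' act' \<gamma>"
  using assms unfolding module_iso_def by simp

lemma isomorphic_modules_trans:
  assumes "isomorphic_modules R s1 act1 s2 act2" "isomorphic_modules R s2 act2 s3 act3"
  shows "isomorphic_modules R s1 act1 s3 act3"
proof -
  obtain f g where "module_iso R s1 act1 s2 act2 f" "module_iso R s2 act2 s3 act3 g"
    using assms by (auto simp: isomorphic_modules_def)
  then have "module_iso R s1 act1 s3 act3 (g \<circ> f)"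
    by (auto simp: module_iso_def bij_comp intro: Vector_Spaces.linear_compose)
  then show ?thesis by (auto simp: isomorphic_modules_def)
qed

lemma isomorphic_modules_sym:
  assumes "isomorphic_modules R s1 act1 s2 act2"
  shows "isomorphic_modules R s2 act2 s1 act1"
proof -
  obtain f where f: "module_iso R s1 act1 s2 act2 f"
    using assms by (auto simp: isomorphic_modules_def)
  then have b: "bij f" and lin: "Vector_Spaces.linear s1 s2 f"
    by (auto simp: module_iso_def)
  interpret f: Vector_Spaces.linear s1 s2 f by (rule lin)
  have inv: "inv_into UNIV f (f x) = x" "f (inv_into UNIV f y) = y" for x y
    using b by (simp_all add: bij_is_inj bij_is_surj surj_f_inv_f)
  have "Vector_Spaces.linear s2 s1 (inv_into UNIV f)"
    unfolding Vector_Spaces.linear_iff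
    by (intro conjI allI f.vs1.vector_space_axioms f.vs2.vector_space_axioms;
        rule injD[OF bij_is_inj[OF b]]; simp add: inv f.add f.scale)
  moreover have "act1 x (inv_into UNIV f v) = inv_into UNIV f (act2 x v)" if "x \<in> carrier R" for x v
    using f that by (metis module_iso_def inv)
  ultimately have "module_iso R s2 act2 s1 act1 (inv_into UNIV f)"
    using f by (simp add: module_iso_def bij_imp_bij_inv)
  then show ?thesis by (auto simp: isomorphic_modules_def)
qed

context algebra_module
begin

lemma act_zero: "act \<zero> v = 0"
  using act_add[of \<zero> \<zero> v] by simp

lemma act_diff:
  assumes "x \<in> carrier R" "y \<in> carrier R"
  shows "act (x \<ominus> y) v = act x v - act y v"
proof -
  have "act (x \<ominus> y) v + act y v = act ((x \<ominus> y) \<oplus> y) v"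
    using assms by (simp add: act_add)
  also have "(x \<ominus> y) \<oplus> y = x"
    using assms by (simp add: a_minus_def a_assoc l_neg)
  finally show ?thesis by (simp add: algebra_simps)
qed

lemma comm_closed: "x \<in> carrier R \<Longrightarrow> y \<in> carrier R \<Longrightarrow> comm R x y \<in> carrier R"
  by (simp add: comm_def)

lemma qcomm_closed: "x \<in> carrier R \<Longrightarrow> y \<in> carrier R \<Longrightarrow> qcomm R p x y \<in> carrier R"
  by (simp add: qcomm_def smult_closed)

context
  fixes x y v c \<theta> w and I :: "'i set"
  assumes xy: "x \<in> carrier R" "y \<in> carrier R"
    and v: "act x v = scale c v"
    and yv: "act y v = (\<Sum>i\<in>I. w i)"
    and w: "\<And>i. i \<in> I \<Longrightarrow> act x (w i) = scale (\<theta> i) (w i)"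
begin

lemma act_eigen_products:
  "act (x \<otimes> y) v = (\<Sum>i\<in>I. scale (\<theta> i) (w i))" "act (y \<otimes> x) v = (\<Sum>i\<in>I. scale c (w i))"
proof -
  interpret X: Vector_Spaces.linear scale scale "act x" by (rule act_linear[OF xy(1)])
  interpret Y: Vector_Spaces.linear scale scale "act y" by (rule act_linear[OF xy(2)])
  show "act (x \<otimes> y) v = (\<Sum>i\<in>I. scale (\<theta> i) (w i))"
    using xy w by (simp add: act_mult yv X.sum)
  show "act (y \<otimes> x) v = (\<Sum>i\<in>I. scale c (w i))"
    using xy by (simp add: act_mult v Y.scale yv scale_sum_right)
qed

lemma act_comm_eigenvector: "act (comm R x y) v = (\<Sum>i\<in>I. scale (\<theta> i - c) (w i))"
  using xy by (simp add: comm_def act_diff act_eigen_products sum_subtractf scale_left_diff_distrib)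

lemma act_qcomm_eigenvector:
  "act (qcomm R p x y) v = (\<Sum>i\<in>I. scale (p * \<theta> i - inverse p * c) (w i))"
  using xy by (simp add: qcomm_def act_diff act_smult smult_closed act_eigen_products sum_subtractf
      scale_left_diff_distrib scale_sum_right)

end

text \<open>
  Each bracket with \<open>x\<close> multiplies the component \<open>w i\<close> by one scalar. The scalar of the outer commutator
  is a common factor of both sides of the relation. Where the relator acts as 0, this forces every
  component of \<open>act y v\<close> with a nonzero coefficient to vanish.
\<close>
lemma act_onsager_relator_eigenvector:
  assumes xy: "x \<in> carrier R" "y \<in> carrier R"
    and v: "act x v = scale c v" and yv: "act y v = (\<Sum>i\<in>I. w i)"
    and w: "\<And>i. i \<in> I \<Longrightarrow> act x (w i) = scale (\<theta> i) (w i)"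
  shows "act (onsager_relator R q x y) v =
    (\<Sum>i\<in>I. scale ((\<theta> i - c) * ((inverse q * \<theta> i - q * c) * (q * \<theta> i - inverse q * c)
                 + (q\<^sup>2 - (inverse q)\<^sup>2)\<^sup>2)) (w i))"
proof -
  interpret X: Vector_Spaces.linear scale scale "act x" by (rule act_linear[OF xy(1)])
  let ?y1 = "qcomm R q x y" and ?y2 = "qcomm R (inverse q) x (qcomm R q x y)"
  have cl: "?y1 \<in> carrier R" "?y2 \<in> carrier R" using xy by (simp_all add: qcomm_closed)
  define w1 where "w1 i = scale (q * \<theta> i - inverse q * c) (w i)" for i
  define w2 where "w2 i = scale (inverse q * \<theta> i - inverse (inverse q) * c) (w1 i)" for i
  have ev: "act x (w1 i) = scale (\<theta> i) (w1 i)" "act x (w2 i) = scale (\<theta> i) (w2 i)" if "i \<in> I" for i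
    using that by (simp_all add: w1_def w2_def X.scale w mult_ac)
  have 1: "act ?y1 v = (\<Sum>i\<in>I. w1 i)"
    unfolding w1_def using xy v yv w by (rule act_qcomm_eigenvector)
  have 2: "act ?y2 v = (\<Sum>i\<in>I. w2 i)"
    unfolding w2_def using xy(1) cl(1) v 1 ev(1) by (rule act_qcomm_eigenvector)
  have 3: "act (comm R x ?y2) v = (\<Sum>i\<in>I. scale (\<theta> i - c) (w2 i))"
    using xy(1) cl(2) v 2 ev(2) by (rule act_comm_eigenvector)
  have "act (x \<otimes> y) v = (\<Sum>i\<in>I. scale (\<theta> i) (w i))"
    using xy v yv w by (rule act_eigen_products(1))
  moreover have "act (y \<otimes> x) v = (\<Sum>i\<in>I. scale c (w i))"
    using xy v yv w by (rule act_eigen_products(2))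
  ultimately have 4: "act (comm R y x) v = (\<Sum>i\<in>I. scale (c - \<theta> i) (w i))"
    using xy by (simp add: comm_def act_diff sum_subtractf scale_left_diff_distrib)
  let ?k = "(q\<^sup>2 - (inverse q)\<^sup>2)\<^sup>2"
  have "act (onsager_relator R q x y) v =
      (\<Sum>i\<in>I. scale (\<theta> i - c) (w2 i)) - scale ?k (\<Sum>i\<in>I. scale (c - \<theta> i) (w i))"
    using xy cl unfolding onsager_relator_def
    by (simp add: act_diff act_smult comm_closed smult_closed 3 4)
  also have "\<dots> = (\<Sum>i\<in>I. scale (\<theta> i - c) (w2 i) - scale ?k (scale (c - \<theta> i) (w i)))"
    by (simp add: scale_sum_right sum_subtractf)
  also have "\<dots> = (\<Sum>i\<in>I. scale ((\<theta> i - c) * ((inverse q * \<theta> i - q * c) *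
      (q * \<theta> i - inverse q * c) + ?k)) (w i))"
  proof (rule sum.cong[OF refl])
    fix i
    have collect: "(\<theta> i - c) * m - k * (c - \<theta> i) = (\<theta> i - c) * (m + k)" for m k
      by (simp add: algebra_simps)
    have "scale (\<theta> i - c) (w2 i) - scale ?k (scale (c - \<theta> i) (w i)) =
        scale ((\<theta> i - c) * ((inverse q * \<theta> i - q * c) * (q * \<theta> i - inverse q * c))
               - ?k * (c - \<theta> i)) (w i)"
      by (simp only: w2_def w1_def scale_scale inverse_inverse_eq mult.assoc
          flip: scale_left_diff_distrib)
    also have "(\<theta> i - c) * ((inverse q * \<theta> i - q * c) * (q * \<theta> i - inverse q * c))
          - ?k * (c - \<theta> i)
        = (\<theta> i - c) * ((inverse q * \<theta> i - q * c) * (q * \<theta> i - inverse q * c) + ?k)"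
      by (rule collect)
    finally show "scale (\<theta> i - c) (w2 i) - scale ?k (scale (c - \<theta> i) (w i)) =
        scale ((\<theta> i - c) * ((inverse q * \<theta> i - q * c) * (q * \<theta> i - inverse q * c) + ?k)) (w i)" .
  qed
  finally show ?thesis .
qed

end

section \<open>The q-Onsager algebra is generated by its two generators\<close>

text \<open>
  Every element is the coset of a linear combination of words, and a word is a product of letters.
\<close>
lemma q_onsager_induct [consumes 1, case_names A Astar one add mult smult]:
  assumes "x \<in> carrier (q_onsager q)"
    and A: "P (gen_A q)" and Astar: "P (gen_Astar q)" and one: "P \<one>\<^bsub>q_onsager q\<^esub>"
    and add: "\<And>x y. x \<in> carrier (q_onsager q) \<Longrightarrow> y \<in> carrier (q_onsager q) \<Longrightarrow>
      P x \<Longrightarrow> P y \<Longrightarrow> P (x \<oplus>\<^bsub>q_onsager q\<^esub> y)"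
    and mult: "\<And>x y. x \<in> carrier (q_onsager q) \<Longrightarrow> y \<in> carrier (q_onsager q) \<Longrightarrow>
      P x \<Longrightarrow> P y \<Longrightarrow> P (x \<otimes>\<^bsub>q_onsager q\<^esub> y)"
    and smult: "\<And>c x. x \<in> carrier (q_onsager q) \<Longrightarrow> P x \<Longrightarrow> P (c \<odot>\<^bsub>q_onsager q\<^esub> x)"
  shows "P x"
proof -
  let ?\<pi> = "\<lambda>f. onsager_ideal q +>\<^bsub>free_algebra\<^esub> f"
  interpret \<pi>: ring_hom_ring free_algebra "q_onsager q" ?\<pi>
    unfolding q_onsager_def
    by (rule quot_algebra_hom(1)[OF assoc_algebra_free_algebra ideal_onsager_ideal])
  have closed: "?\<pi> f \<in> carrier (q_onsager q)" for f by (rule \<pi>.hom_closed) simp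
  have \<pi>_smult: "?\<pi> (Poly_Mapping.single 0 c * f) = c \<odot>\<^bsub>q_onsager q\<^esub> ?\<pi> f" for c f
    using quot_algebra_hom(2)[OF assoc_algebra_free_algebra ideal_onsager_ideal, of f q c]
    by (simp add: q_onsager_def)
  have \<pi>_add: "?\<pi> (f + g) = ?\<pi> f \<oplus>\<^bsub>q_onsager q\<^esub> ?\<pi> g" for f g
    using \<pi>.hom_add[of f g] by simp
  have \<pi>_mult: "?\<pi> (f * g) = ?\<pi> f \<otimes>\<^bsub>q_onsager q\<^esub> ?\<pi> g" for f g
    using \<pi>.hom_mult[of f g] by simp
  have word: "P (?\<pi> (Poly_Mapping.single (Word gs) 1))" for gs
  proof (induction gs)
    case Nil
    have "Poly_Mapping.single (Word []) 1 = (1 :: onsager_gen word \<Rightarrow>\<^sub>0 'a)"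
      by (simp add: zero_word_def[symmetric])
    then show ?case using one \<pi>.hom_one by simp
  next
    case (Cons g gs)
    have "P (?\<pi> (letter g))"
      using A Astar by (cases g) (simp_all add: gen_A_def gen_Astar_def)
    moreover have "Poly_Mapping.single (Word (g # gs)) (1::'a)
        = letter g * Poly_Mapping.single (Word gs) 1"
      by (simp add: letter_def mult_single plus_word_def)
    ultimately show ?case using Cons by (simp add: \<pi>_mult mult closed)
  qed
  have monomial: "P (?\<pi> (Poly_Mapping.single u c))" for u c
  proof -
    \<comment> \<open>The scalar \<open>c\<close> of the free algebra is the monomial with coefficient \<open>c\<close> at the empty word, written \<open>0\<close>.\<close>
    have "Poly_Mapping.single u c = Poly_Mapping.single 0 c * Poly_Mapping.single (Word (letters u)) 1"
      by (simp add: mult_single)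
    then show ?thesis by (simp add: \<pi>_smult smult closed word del: word.collapse)
  qed
  have "P (?\<pi> f)" for f
  proof (induction f rule: update_induct)
    case const
    have "?\<pi> 0 = ?\<pi> (Poly_Mapping.single 0 0)" by simp
    then show ?case using monomial[of 0 0] by simp
  next
    case (update f u c)
    have "Poly_Mapping.update u c f = Poly_Mapping.single u c + f"
      using update(1)
      by (intro poly_mapping_eqI)
        (auto simp: lookup_update lookup_add lookup_single in_keys_iff when_def)
    then show ?case using update(3) monomial by (simp add: \<pi>_add add closed)
  qed
  moreover obtain f where "x = ?\<pi> f"
    using assms(1)
    by (auto simp: q_onsager_def quot_algebra_def FactRing_def A_RCOSETS_def' a_r_coset_def)
  ultimately show ?thesis by simp
qed

lemma module_iso_q_onsagerI:
  assumes M: "algebra_module (q_onsager q) scale act" and M': "algebra_module (q_onsager q) scale' act'"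
    and lin: "Vector_Spaces.linear scale scale' \<gamma>" and bij: "bij \<gamma>"
    and A: "\<And>v. act' (gen_A q) (\<gamma> v) = \<gamma> (act (gen_A q) v)"
    and Astar: "\<And>v. act' (gen_Astar q) (\<gamma> v) = \<gamma> (act (gen_Astar q) v)"
  shows "module_iso (q_onsager q) scale act scale' act' \<gamma>"
proof -
  interpret M: algebra_module "q_onsager q" scale act by fact
  interpret M': algebra_module "q_onsager q" scale' act' by fact
  interpret \<gamma>: Vector_Spaces.linear scale scale' \<gamma> by fact
  have "\<forall>v. act' x (\<gamma> v) = \<gamma> (act x v)" if "x \<in> carrier (q_onsager q)" for x
    using that
  proof (induction rule: q_onsager_induct)
    case (add x y)
    then show ?case by (simp add: M.act_add M'.act_add \<gamma>.add)
  next
    case (mult x y)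
    then show ?case by (simp add: M.act_mult M'.act_mult)
  next
    case (smult c x)
    then show ?case by (simp add: M.act_smult M'.act_smult \<gamma>.scale)
  qed (simp_all add: A Astar M.act_one M'.act_one)
  with M M' lin bij show ?thesis by (simp add: module_iso_def)
qed

section \<open>The isomorphism\<close>

locale onsager_module = onsager_eigenvalues q a d \<theta> + algebra_module "q_onsager q" scale act +
  eigendecomposition scale "act (gen_A q)" d \<theta>
  for q a :: "'f::field" and d \<theta> and scale :: "'f \<Rightarrow> 'v::ab_group_add \<Rightarrow> 'v" and act
begin

abbreviation H :: "'v \<Rightarrow> 'v" where "H \<equiv> H_map scale q (act (gen_A q)) d \<theta>"

text \<open>
  The first defining relation acts as 0 and multiplies the component \<open>w i\<close> by a scalar that is nonzero
  for such \<open>i\<close>.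
\<close>
lemma Astar_tridiagonal:
  assumes j: "j \<le> d" "v \<in> eigenspace scale (act (gen_A q)) (\<theta> j)"
    and w: "eigenfamily w" "act (gen_Astar q) v = (\<Sum>i=0..d. w i)"
    and i: "i \<le> d" "i \<noteq> j" "j \<noteq> Suc i" "i \<noteq> Suc j"
  shows "w i = 0"
proof -
  let ?p = "\<lambda>i. (\<theta> i - \<theta> j) * ((inverse q * \<theta> i - q * \<theta> j) * (q * \<theta> i - inverse q * \<theta> j)
                   + (q\<^sup>2 - (inverse q)\<^sup>2)\<^sup>2)"
  have v: "act (gen_A q) v = scale (\<theta> j) v" using j(2) by (simp add: eigenspace_def)
  have "act (gen_A q) (w k) = scale (\<theta> k) (w k)" if "k \<in> {0..d}" for k
    using w(1) that by (simp add: eigenspace_def)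
  with gen_A_carrier gen_Astar_carrier v w(2)
  have "act (onsager_relator (q_onsager q) q (gen_A q) (gen_Astar q)) v
      = (\<Sum>i=0..d. scale (?p i) (w i))"
    by (rule act_onsager_relator_eigenvector)
  then have "(\<Sum>i=0..d. scale (?p i) (w i)) = 0"
    by (simp add: q_onsager_relations act_zero)
  moreover have "eigenfamily (\<lambda>i. scale (?p i) (w i))"
    using w(1) by (auto intro: subspace_scale subspace_eigenspace)
  ultimately have "scale (?p i) (w i) = 0"
    using i(1) by (simp add: eigenfamily_sum_eq_0_iff)
  moreover have "?p i \<noteq> 0"
    using relation_polynomial_nonzero[OF i(1) j(1) i(2-4)] i(1,2) j(1)
    by (simp add: inj_on_eq_iff[OF inj])
  ultimately show ?thesis by simp
qed

lemma H_intertwines_A: "act (gen_A q) (H v) = H (act (gen_A q) v)"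
proof -
  have "Vector_Spaces.linear scale scale (\<lambda>v. act (gen_A q) (H v))"
    "Vector_Spaces.linear scale scale (\<lambda>v. H (act (gen_A q) v))"
    using Vector_Spaces.linear_compose[OF linear_H_map linear_op]
      Vector_Spaces.linear_compose[OF linear_op linear_H_map] by (simp_all add: o_def)
  then show ?thesis
  proof (rule linear_eqI_eigenvectors)
    fix j v assume "j \<le> d" and v: "v \<in> eigenspace scale (act (gen_A q)) (\<theta> j)"
    moreover from v have "act (gen_A q) v \<in> eigenspace scale (act (gen_A q)) (\<theta> j)"
      by (simp add: eigenspace_def op.scale)
    ultimately show "act (gen_A q) (H v) = H (act (gen_A q) v)"
      by (simp add: H_map_eigenvector op.scale)
  qed
qed

abbreviation lusztig_Astar :: "'f onsager" where
  "lusztig_Astar \<equiv> gen_Astar q \<oplus>\<^bsub>q_onsager q\<^esub>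
     (inverse ((q - inverse q) * (q\<^sup>2 - (inverse q)\<^sup>2)) \<odot>\<^bsub>q_onsager q\<^esub>
       comm (q_onsager q) (gen_A q) (qcomm (q_onsager q) q (gen_A q) (gen_Astar q)))"

lemma lusztig_Astar_closed: "lusztig_Astar \<in> carrier (q_onsager q)"
  by (simp add: smult_closed comm_closed qcomm_closed gen_A_carrier gen_Astar_carrier)

text \<open>
  The inner \<open>q\<close>-commutator contributes the factor \<open>q \<theta>\<^sub>i - q\<inverse> \<theta>\<^sub>j\<close> and the outer commutator the factor
  \<open>\<theta>\<^sub>i - \<theta>\<^sub>j\<close>; this is where the formula for \<open>t\<^sub>i\<^sub>j\<close> comes from.
\<close>
lemma act_lusztig_Astar:
  assumes v: "v \<in> eigenspace scale (act (gen_A q)) (\<theta> j)"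
    and w: "eigenfamily w" "act (gen_Astar q) v = (\<Sum>i=0..d. w i)"
  shows "act lusztig_Astar v = (\<Sum>i=0..d. scale (t_pair q \<theta> i j) (w i))"
proof -
  let ?y = "qcomm (q_onsager q) q (gen_A q) (gen_Astar q)"
  let ?u = "\<lambda>i. scale (q * \<theta> i - inverse q * \<theta> j) (w i)"
  have y: "?y \<in> carrier (q_onsager q)" by (simp add: qcomm_closed gen_A_carrier gen_Astar_carrier)
  have v': "act (gen_A q) v = scale (\<theta> j) v" using v by (simp add: eigenspace_def)
  have ev: "act (gen_A q) (w k) = scale (\<theta> k) (w k)" if "k \<in> {0..d}" for k
    using w(1) that by (simp add: eigenspace_def)
  then have ev': "act (gen_A q) (?u k) = scale (\<theta> k) (?u k)" if "k \<in> {0..d}" for k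
    using that by (simp add: op.scale mult.commute)
  from gen_A_carrier gen_Astar_carrier v' w(2) ev
  have "act ?y v = (\<Sum>i=0..d. ?u i)" by (rule act_qcomm_eigenvector)
  with gen_A_carrier y v'
  have "act (comm (q_onsager q) (gen_A q) ?y) v = (\<Sum>i=0..d. scale (\<theta> i - \<theta> j) (?u i))"
    using ev' by (rule act_comm_eigenvector)
  then show ?thesis
    using y by (simp add: act_add act_smult smult_closed comm_closed gen_A_carrier gen_Astar_carrier
        w(2) t_pair_def scale_left_distrib sum.distrib scale_sum_right divide_inverse mult_ac)
qed

text \<open>
  On an eigenvector for \<open>\<theta>\<^sub>j\<close>, both sides are compared component by component: the right-hand side
  multiplies the component \<open>i\<close> of \<open>A* v\<close> by \<open>t\<^sub>i t\<^sub>i\<^sub>j\<close>, the left-hand side by \<open>t\<^sub>j\<close>.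
\<close>
lemma H_intertwines_Astar: "act (gen_Astar q) (H v) = H (act lusztig_Astar v)"
proof -
  have "Vector_Spaces.linear scale scale (\<lambda>v. act (gen_Astar q) (H v))"
    "Vector_Spaces.linear scale scale (\<lambda>v. H (act lusztig_Astar v))"
    using Vector_Spaces.linear_compose[OF linear_H_map act_linear[OF gen_Astar_carrier]]
      Vector_Spaces.linear_compose[OF act_linear[OF lusztig_Astar_closed] linear_H_map]
    by (simp_all add: o_def)
  then show ?thesis
  proof (rule linear_eqI_eigenvectors)
    fix j v assume j: "j \<le> d" and v: "v \<in> eigenspace scale (act (gen_A q)) (\<theta> j)"
    interpret Astar: Vector_Spaces.linear scale scale "act (gen_Astar q)"
      by (rule act_linear[OF gen_Astar_carrier])
    obtain w where w: "eigenfamily w" "act (gen_Astar q) v = (\<Sum>i=0..d. w i)"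
      by (rule obtain_eigenfamily)
    have "eigenfamily (\<lambda>i. scale (t_pair q \<theta> i j) (w i))"
      using w(1) by (auto intro: subspace_scale subspace_eigenspace)
    from H_map_sum[OF this, of q] act_lusztig_Astar[OF v w]
    have "H (act lusztig_Astar v) = (\<Sum>i=0..d. scale (t_coeff q \<theta> i * t_pair q \<theta> i j) (w i))"
      by simp
    also have "\<dots> = (\<Sum>i=0..d. scale (t_coeff q \<theta> j) (w i))"
    proof (rule sum.cong[OF refl])
      fix i assume "i \<in> {0..d}"
      then show "scale (t_coeff q \<theta> i * t_pair q \<theta> i j) (w i) = scale (t_coeff q \<theta> j) (w i)"
        using t_coeff_intertwines[of i j] Astar_tridiagonal[OF j v w, of i] j
        by (cases "i = j \<or> j = Suc i \<or> i = Suc j") auto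
    qed
    also have "\<dots> = act (gen_Astar q) (H v)"
      by (simp add: H_map_eigenvector[OF j v] Astar.scale w(2) scale_sum_right)
    finally show "act (gen_Astar q) (H v) = H (act lusztig_Astar v)" ..
  qed
qed

lemma H_module_iso_from_inverse_twist:
  assumes L: "is_lusztig_aut q L"
  shows "module_iso (q_onsager q) scale (twist (q_onsager q) (alg_inv (q_onsager q) L) act) scale act H"
proof (rule module_iso_q_onsagerI)
  have aut: "L \<in> algebra_aut (q_onsager q)" and LA: "L (gen_A q) = gen_A q"
    and LAstar: "L (gen_Astar q) = lusztig_Astar"
    using L by (auto simp: is_lusztig_aut_def)
  show M: "algebra_module (q_onsager q) scale act" by (rule algebra_module_axioms)
  show "algebra_module (q_onsager q) scale (twist (q_onsager q) (alg_inv (q_onsager q) L) act)"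
    by (intro algebra_module_twist M alg_inv_aut assoc_algebra_q_onsager aut)
  show "Vector_Spaces.linear scale scale H" by (rule linear_H_map)
  show "bij H" by (rule bij_H_map) (rule t_coeff_nonzero)
  have "twist (q_onsager q) (alg_inv (q_onsager q) L) act x = act (L x)"
    if "x \<in> carrier (q_onsager q)" for x
    by (simp add: twist_def alg_inv_alg_inv[OF aut that])
  then show "act (gen_A q) (H v) = H (twist (q_onsager q) (alg_inv (q_onsager q) L) act (gen_A q) v)"
    "act (gen_Astar q) (H v) = H (twist (q_onsager q) (alg_inv (q_onsager q) L) act (gen_Astar q) v)"
    for v
    by (simp_all only: gen_A_carrier gen_Astar_carrier LA LAstar H_intertwines_A H_intertwines_Astar)
qed

text \<open>Twisting via \<open>L\<close> undoes the twist via its inverse, which turns the previous isomorphism into this one.\<close>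
lemma H_module_iso_to_twist:
  assumes L: "is_lusztig_aut q L"
  shows "module_iso (q_onsager q) scale act scale (twist (q_onsager q) L act) H"
proof -
  have aut: "L \<in> algebra_aut (q_onsager q)" using L by (simp add: is_lusztig_aut_def)
  have "twist (q_onsager q) L (twist (q_onsager q) (alg_inv (q_onsager q) L) act) x = act x"
    if "x \<in> carrier (q_onsager q)" for x
    using that by (simp add: twist_def alg_inv_alg_inv[OF aut] alg_inv_closed[OF aut] aut_alg_inv[OF aut])
  with module_iso_twist[OF H_module_iso_from_inverse_twist[OF L] aut] algebra_module_axioms
  show ?thesis by (auto intro: module_iso_cong)
qed

end

theorem proposition3p10:
  fixes q a :: "'f::field"
    and scale :: "'f \<Rightarrow> 'v::ab_group_add \<Rightarrow> 'v"
    and act :: "'f onsager \<Rightarrow> 'v \<Rightarrow> 'v"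
    and L :: "'f onsager \<Rightarrow> 'f onsager"
    and d :: nat
    and \<theta> :: "nat \<Rightarrow> 'f"
  assumes "q \<noteq> 0"
    and "\<forall>n::nat. n > 0 \<longrightarrow> q ^ n \<noteq> 1"
    and "irreducible_module (q_onsager q) scale act"
    and "\<exists>B. finite B \<and> module.span scale B = (UNIV :: 'v set)"
    and "vector_space.dim scale (UNIV :: 'v set) \<ge> 2"
    and "diagonalizable scale (act (gen_A q))"
    and "diagonalizable scale (act (gen_Astar q))"
    and "d \<ge> 1"
    and "a \<noteq> 0"
    and "inj_on \<theta> {0..d}"
    and "eigenvalues scale (act (gen_A q)) = \<theta> ` {0..d}"
    and "\<forall>i \<le> d. \<theta> i = a * q powi (int d - 2 * int i) + inverse a * q powi (2 * int i - int d)"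
    and "is_lusztig_aut q L"
  shows
    "isomorphic_modules (q_onsager q) scale act scale (twist (q_onsager q) L act) \<and>
     isomorphic_modules (q_onsager q) scale act
       scale (twist (q_onsager q) (alg_inv (q_onsager q) L) act) \<and>
     isomorphic_modules (q_onsager q) scale (twist (q_onsager q) L act)
       scale (twist (q_onsager q) (alg_inv (q_onsager q) L) act) \<and>
     module_iso (q_onsager q) scale act scale (twist (q_onsager q) L act)
       (H_map scale q (act (gen_A q)) d \<theta>) \<and>
     module_iso (q_onsager q) scale (twist (q_onsager q) (alg_inv (q_onsager q) L) act)
       scale act (H_map scale q (act (gen_A q)) d \<theta>)"
proof -
  note scalars = assms(1,2) and irreducible = assms(3) and diag = assms(6)
    and eigenvalues = assms(9-12) and L = assms(13)
  let ?O = "q_onsager q"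
  interpret M: algebra_module ?O scale act
    using irreducible by (simp add: irreducible_module_def)
  interpret onsager_module q a d \<theta> scale act
  proof unfold_locales
    show "M.span (\<Union>i\<in>{0..d}. eigenspace scale (act (gen_A q)) (\<theta> i)) = UNIV"
      by (rule M.diagonalizable_span_eigenspaces[OF diag eigenvalues(3)])
  qed (use scalars eigenvalues M.act_linear[OF gen_A_carrier] in
      \<open>auto simp: Vector_Spaces.linear_iff\<close>)
  let ?H = "H_map scale q (act (gen_A q)) d \<theta>"
  have to_twist: "module_iso ?O scale act scale (twist ?O L act) ?H"
    by (rule H_module_iso_to_twist[OF L])
  have from_inv: "module_iso ?O scale (twist ?O (alg_inv ?O L) act) scale act ?H"
    by (rule H_module_iso_from_inverse_twist[OF L])
  have 12: "isomorphic_modules ?O scale act scale (twist ?O L act)"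
    using to_twist by (auto simp: isomorphic_modules_def)
  have 13: "isomorphic_modules ?O scale act scale (twist ?O (alg_inv ?O L) act)"
    by (rule isomorphic_modules_sym) (use from_inv in \<open>auto simp: isomorphic_modules_def\<close>)
  show ?thesis
    using 12 13 isomorphic_modules_trans[OF isomorphic_modules_sym[OF 12] 13] to_twist from_inv
    by blast
qed

end
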